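(* Let $\Phi$ be a convex battery cycle aging stress function, let $e_0\in[E^{\mathrm{min}},E^{\mathrm{max}}]$, and let $(\mathbf d,\mathbf g)\in\mathcal P(e_0)$ be a feasible battery dispatch profile. For $J\ge1$ let $\mathbf c(\Phi)$ with $|\mathbf c(\Phi)|=J$ denote the $J$-segment piecewise linearization of $\Phi$. When the number of linearization segments approaches infinity, the piecewise linear cost model yields the same result as the benchmark rainflow-based cost model: $$\lim_{|\mathbf c(\Phi)|\to\infty}C^{\mathrm{pwl}}\big(\mathbf c(\Phi),\mathbf d,\mathbf g\big)=C^{\mathrm{ben}}\big(\Phi,\mathbf d,\mathbf g\big).$$
   Context: Battery. $\mathcal T=\{1,\dots,T\}$ is the set of time intervals, each of duration $M>0$. $E^{\mathrm{rate}}>0$ is the energy capacity; $0\le E^{\mathrm{min}}\le E^{\mathrm{max}}\le E^{\mathrm{rate}}$ are the minimum and maximum stored energy; $\eta^{\mathrm{ch}},\eta^{\mathrm{dis}}\in(0,1]$ are the charge and discharge efficiencies; $D,G\ge0$ bound the charging and discharging power; $R>0$ is the battery cell replacement cost. $\mathcal P(e_0)$ is the set of all $(\mathbf d,\mathbf g)$, $\mathbf d=(d_1,\dots,d_T)$ (charging powers), $\mathbf g=(g_1,\dots,g_T)$ (discharging powers), for which there are $v_t\in\{0,1\}$ and energy levels $e_1,\dots,e_T$ with, for all $t\in\mathcal T$: $0\le d_t\le D(1-v_t)$, $0\le g_t\le Gv_t$, $e_t-e_{t-1}=M(d_t\eta^{\mathrm{ch}}-g_t/\eta^{\mathrm{dis}})$,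 $E^{\mathrm{min}}\le e_t\le E^{\mathrm{max}}$. Stress function and linearization. $\Phi:[0,1]\to[0,\infty)$ gives the life loss of a cycle of depth $\delta$; it is differentiable with $\Phi(0)=0$. Its $J$-segment linearization is $\mathbf c(\Phi)=\{c_1,\dots,c_J\}$, $c_j=\frac{R}{\eta^{\mathrm{dis}}E^{\mathrm{rate}}}J\big[\Phi(\tfrac jJ)-\Phi(\tfrac{j-1}J)\big]$. Each segment has energy capacity $\overline e_j=E^{\mathrm{rate}}/J$. Piecewise linear cost. $C^{\mathrm{pwl}}(\mathbf c,\mathbf d,\mathbf g)=\sum_{t=1}^{T}\sum_{j=1}^{J}Mc_j\hat p^{\mathrm{dis}}_{t,j}$, where, recursively in $t$ and then in $j$ (empty sums are $0$), $\hat p^{\mathrm{ch}}_{t,j}=\min\big[d_t-\sum_{\zeta=1}^{j-1}\hat p^{\mathrm{ch}}_{t,\zeta},\ (\overline e_j-\hat e_{t-1,j})/(\eta^{\mathrm{ch}}M)\big]$, $\hat p^{\mathrm{dis}}_{t,j}=\min\big[g_t-\sum_{\zeta=1}^{j-1}\hat p^{\mathrm{dis}}_{t,\zeta},\ \eta^{\mathrm{dis}}\hat e_{t-1,j}/M\big]$, $\hat e_{0,j}=\min\big[\overline e_j,\max(0,e_0-\sum_{\zeta=1}^{j-1}\hat e_{0,\zeta})\big]$, $\hat e_{t,j}=\hat e_{t-1,j}+M(\hat p^{\mathrm{ch}}_{t,j}\eta^{\mathrm{ch}}-\hat p^{\mathrm{dis}}_{t,j}/\eta^{\mathrm{dis}})$.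 Rainflow counting. The state-of-charge (SoC) profile of the dispatch is $e_t/E^{\mathrm{rate}}$, $t=0,\dots,T$. Let $s_0,s_1,\dots$ be its successive local extrema (including the initial and final points; consecutive ones differ and alternate in direction). The rainflow method is: (1) start at the beginning of the profile; (2) for the current four consecutive points $s_0,s_1,s_2,s_3$ compute $\Delta s_1=|s_0-s_1|$, $\Delta s_2=|s_1-s_2|$, $\Delta s_3=|s_2-s_3|$; (3) if $\Delta s_2\le\Delta s_1$ and $\Delta s_2\le\Delta s_3$, a full cycle of depth $\Delta s_2$ is identified: remove $s_1,s_2$ from the profile and repeat using $s_0,s_3,s_4,s_5$; (4) otherwise shift forward by one and repeat using $s_1,s_2,s_3,s_4$; (5) repeat until no more full cycles can be identified anywhere in the remaining profile. The remaining profile is the rainflow residue; each pair of adjacent points in it is a half cycle whose depth is the absolute SoC difference, a discharge half cycle if SoC decreases and a charge half cycle if SoC increases. Let $\Delta$ be the collection (with multiplicity) of full cycles, with depths $\delta_i$, and $\Delta^{\mathrm{dis}}$ the collection of discharge half cycles, with depths $\delta^{\mathrm{dis}}_i$. Benchmark cost. $C^{\mathrm{ben}}(\Phi,\mathbf d,\mathbf g)=R\sum_{i=1}^{|\Delta|}\Phi(\delta_i)+R\sum_{i=1}^{|\Delta^{\mathrm{dis}}|}\Phi(\delta^{\mathrm{dis}}_i)$ (charge half cycles cause no aging). *)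

theory Defs
  imports "HOL-Analysis.Analysis"
begin

record battery =
  horizon :: nat         \<comment> \<open>\<open>T\<close>; the time intervals are \<open>1, \<dots>, T\<close>\<close>
  interval :: real       \<comment> \<open>\<open>M\<close>, duration of a time interval\<close>
  E_rate :: real
  E_min :: real
  E_max :: real
  eta_ch :: real
  eta_dis :: real
  charge_limit :: real   \<comment> \<open>\<open>D\<close>\<close>
  discharge_limit :: real \<comment> \<open>\<open>G\<close>\<close>
  cell_cost :: real      \<comment> \<open>\<open>R\<close>, battery cell replacement cost\<close>

definition valid_battery :: "battery \<Rightarrow> bool" where
  "valid_battery B \<longleftrightarrow>
     interval B > 0 \<and> E_rate B > 0 \<and>
     0 \<le> E_min B \<and> E_min B \<le> E_max B \<and> E_max B \<le> E_rate B \<and>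
     0 < eta_ch B \<and> eta_ch B \<le> 1 \<and> 0 < eta_dis B \<and> eta_dis B \<le> 1 \<and>
     charge_limit B \<ge> 0 \<and> discharge_limit B \<ge> 0 \<and> cell_cost B > 0"

text \<open>
  A vector \<open>(x\<^sub>1, \<dots>, x\<^sub>T)\<close> is a function on \<open>nat\<close> of which only the values on
  \<open>{1..T}\<close> are used.
\<close>

definition feasible_dispatches ::
    "battery \<Rightarrow> real \<Rightarrow> ((nat \<Rightarrow> real) \<times> (nat \<Rightarrow> real)) set" where
  "feasible_dispatches B e0 = {(d, g). \<exists>(v :: nat \<Rightarrow> real) (e :: nat \<Rightarrow> real).
     e 0 = e0 \<and>
     (\<forall>t\<in>{1..horizon B}.
        v t \<in> {0, 1} \<and>
        0 \<le> d t \<and> d t \<le> charge_limit B * (1 - v t) \<and>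
        0 \<le> g t \<and> g t \<le> discharge_limit B * v t \<and>
        e t - e (t - 1) = interval B * (d t * eta_ch B - g t / eta_dis B) \<and>
        E_min B \<le> e t \<and> e t \<le> E_max B)}"

text \<open>
  The energy levels of a feasible dispatch are determined by \<open>e\<^sub>0\<close>, \<open>d\<close> and \<open>g\<close>;
  the two costs below therefore take \<open>e\<^sub>0\<close> as an explicit argument.
\<close>

primrec energy_level ::
    "battery \<Rightarrow> real \<Rightarrow> (nat \<Rightarrow> real) \<Rightarrow> (nat \<Rightarrow> real) \<Rightarrow> nat \<Rightarrow> real" where
  "energy_level B e0 d g 0 = e0"
| "energy_level B e0 d g (Suc t) =
     energy_level B e0 d g t
       + interval B * (d (Suc t) * eta_ch B - g (Suc t) / eta_dis B)"

definition stress_function :: "(real \<Rightarrow> real) \<Rightarrow> bool" where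
  "stress_function \<Phi> \<longleftrightarrow>
     (\<forall>\<delta>\<in>{0..1}. 0 \<le> \<Phi> \<delta>) \<and> \<Phi> differentiable_on {0..1} \<and> \<Phi> 0 = 0"


section \<open>Piecewise linear cost\<close>

text \<open>
  The segment costs \<open>c\<^sub>1, \<dots>, c\<^sub>J\<close> form a list, so that equal costs are not identified
  and the length of the list is \<open>J\<close>; \<open>c\<^sub>j\<close> is the list entry at position \<open>j - 1\<close>.
\<close>

definition linearization :: "battery \<Rightarrow> (real \<Rightarrow> real) \<Rightarrow> nat \<Rightarrow> real list" where
  "linearization B \<Phi> J =
     map (\<lambda>j. cell_cost B / (eta_dis B * E_rate B) * real J
               * (\<Phi> (real j / real J) - \<Phi> ((real j - 1) / real J)))
       [1..<Suc J]"

definition segment_capacity :: "battery \<Rightarrow> nat \<Rightarrow> real" where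
  "segment_capacity B J = E_rate B / real J"

fun initial_segment_energy :: "battery \<Rightarrow> nat \<Rightarrow> real \<Rightarrow> nat \<Rightarrow> real" where
  "initial_segment_energy B J e0 j =
     min (segment_capacity B J)
         (max 0 (e0 - (\<Sum>\<zeta>\<in>{1..<j}. initial_segment_energy B J e0 \<zeta>)))"

text \<open>
  The recursion over the segments shared by charging and discharging: segment \<open>j\<close> takes
  what the segments \<open>1, \<dots>, j - 1\<close> leave of the power \<open>x\<close>, up to its own limit \<open>cap j\<close>.
\<close>

fun distribute :: "real \<Rightarrow> (nat \<Rightarrow> real) \<Rightarrow> nat \<Rightarrow> real" where
  "distribute x cap j = min (x - (\<Sum>\<zeta>\<in>{1..<j}. distribute x cap \<zeta>)) (cap j)"

declare initial_segment_energy.simps [simp del] distribute.simps [simp del]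

definition charge_split :: "battery \<Rightarrow> nat \<Rightarrow> real \<Rightarrow> (nat \<Rightarrow> real) \<Rightarrow> nat \<Rightarrow> real" where
  "charge_split B J x \<epsilon> =
     distribute x (\<lambda>j. (segment_capacity B J - \<epsilon> j) / (eta_ch B * interval B))"

definition discharge_split :: "battery \<Rightarrow> real \<Rightarrow> (nat \<Rightarrow> real) \<Rightarrow> nat \<Rightarrow> real" where
  "discharge_split B x \<epsilon> = distribute x (\<lambda>j. eta_dis B * \<epsilon> j / interval B)"

text \<open>\<open>segment_energy B J e0 d g t j\<close> is the energy in segment \<open>j\<close> after interval \<open>t\<close>.\<close>

primrec segment_energy ::
    "battery \<Rightarrow> nat \<Rightarrow> real \<Rightarrow> (nat \<Rightarrow> real) \<Rightarrow> (nat \<Rightarrow> real) \<Rightarrow> nat \<Rightarrow> nat \<Rightarrow> real" where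
  "segment_energy B J e0 d g 0 = initial_segment_energy B J e0"
| "segment_energy B J e0 d g (Suc t) =
     (let \<epsilon> = segment_energy B J e0 d g t in
      (\<lambda>j. \<epsilon> j + interval B * (charge_split B J (d (Suc t)) \<epsilon> j * eta_ch B
                                 - discharge_split B (g (Suc t)) \<epsilon> j / eta_dis B)))"

definition segment_discharge ::
    "battery \<Rightarrow> nat \<Rightarrow> real \<Rightarrow> (nat \<Rightarrow> real) \<Rightarrow> (nat \<Rightarrow> real) \<Rightarrow> nat \<Rightarrow> nat \<Rightarrow> real" where
  "segment_discharge B J e0 d g t j =
     discharge_split B (g t) (segment_energy B J e0 d g (t - 1)) j"

definition pwl_cost ::
    "battery \<Rightarrow> real \<Rightarrow> real list \<Rightarrow> (nat \<Rightarrow> real) \<Rightarrow> (nat \<Rightarrow> real) \<Rightarrow> real" where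
  "pwl_cost B e0 c d g =
     (\<Sum>t\<in>{1..horizon B}. \<Sum>j\<in>{1..length c}.
        interval B * c ! (j - 1) * segment_discharge B (length c) e0 d g t j)"


section \<open>Rainflow counting\<close>

text \<open>Applied to a list without equal neighbours, this drops the points that are not extrema.\<close>

fun drop_intermediate :: "real list \<Rightarrow> real list" where
  "drop_intermediate (a # b # c # xs) =
     (if (a < b \<and> b < c) \<or> (a > b \<and> b > c)
      then drop_intermediate (a # c # xs)
      else a # drop_intermediate (b # c # xs))"
| "drop_intermediate xs = xs"

definition local_extrema :: "real list \<Rightarrow> real list" where
  "local_extrema xs = drop_intermediate (remdups_adj xs)"

text \<open>
  One pass over the profile; the result consists of the depths of the full cycles found
  and the remaining profile.
\<close>

fun rainflow_pass :: "real list \<Rightarrow> real list \<times> real list" where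
  "rainflow_pass (s0 # s1 # s2 # s3 # xs) =
     (if \<bar>s1 - s2\<bar> \<le> \<bar>s0 - s1\<bar> \<and> \<bar>s1 - s2\<bar> \<le> \<bar>s2 - s3\<bar>
      then (let (cs, rest) = rainflow_pass (s0 # s3 # xs) in (\<bar>s1 - s2\<bar> # cs, rest))
      else (let (cs, rest) = rainflow_pass (s1 # s2 # s3 # xs) in (cs, s0 # rest)))"
| "rainflow_pass xs = ([], xs)"

lemma length_rainflow_pass:
  "length (snd (rainflow_pass xs)) + 2 * length (fst (rainflow_pass xs)) = length xs"
  by (induction xs rule: rainflow_pass.induct) (auto split: prod.splits)

text \<open>Passes are repeated until one finds no full cycle.\<close>

function rainflow :: "real list \<Rightarrow> real list \<times> real list" where
  "rainflow xs =
     (let (cs, rest) = rainflow_pass xs in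
      if cs = [] then ([], rest)
      else (let (cs', residue) = rainflow rest in (cs @ cs', residue)))"
  by pat_completeness auto

termination
proof (relation "Wellfounded.measure length")
  fix xs :: "real list" and p cs rest
  assume "p = rainflow_pass xs" "(cs, rest) = p" "cs \<noteq> []"
  then show "(rest, xs) \<in> Wellfounded.measure length"
    using length_rainflow_pass[of xs] by (cases cs) (auto dest: sym)
qed simp

declare rainflow.simps [simp del]

definition discharge_half_cycles :: "real list \<Rightarrow> real list" where
  "discharge_half_cycles r = [\<bar>a - b\<bar>. (a, b) \<leftarrow> zip r (tl r), b < a]"

definition soc_profile ::
    "battery \<Rightarrow> real \<Rightarrow> (nat \<Rightarrow> real) \<Rightarrow> (nat \<Rightarrow> real) \<Rightarrow> real list" where
  "soc_profile B e0 d g =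
     map (\<lambda>t. energy_level B e0 d g t / E_rate B) [0..<Suc (horizon B)]"

definition benchmark_cost ::
    "battery \<Rightarrow> real \<Rightarrow> (real \<Rightarrow> real) \<Rightarrow> (nat \<Rightarrow> real) \<Rightarrow> (nat \<Rightarrow> real) \<Rightarrow> real" where
  "benchmark_cost B e0 \<Phi> d g =
     (let (full, residue) = rainflow (local_extrema (soc_profile B e0 d g)) in
      cell_cost B * (\<Sum>\<delta>\<leftarrow>full. \<Phi> \<delta>)
      + cell_cost B * (\<Sum>\<delta>\<leftarrow>discharge_half_cycles residue. \<Phi> \<delta>))"

end

theory Submission
  imports Defs
begin

text \<open>
  Fix the number \<open>J\<close> of segments and look at the energy that the first \<open>k\<close> segments hold
  together. Charging fills the low segments first, so it raises this amount until the \<open>k\<close>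
  segments are full; discharging empties the low segments first, so it lowers the amount until
  they are empty. Relative to the rated energy, this amount is therefore driven by the state of
  charge through a clipped sum \<open>max 0 (min h (f + x))\<close> with threshold \<open>h = k / J\<close>: the stop
  operator of hysteresis theory (\<open>filled_step\<close>). What the first \<open>k\<close> segments discharge is
  the total decrease of this scalar state, and the \<open>J\<close>-dimensional recursion falls apart
  into \<open>J\<close> scalar ones.

  Rainflow counting describes the memory of the stop operator exactly. At the end of a full
  cycle of depth \<open>\<delta>\<close> the operator is where it would be without the cycle, and the cycle has
  added \<open>min \<delta> h\<close> to the total decrease (\<open>stop_cycle\<close>). In the residue the cycle depths first
  grow and then shrink, and each discharge half cycle of depth \<open>\<delta>\<close> contributes \<open>min \<delta> h\<close> again
  (\<open>drained_residue\<close>). Hence, at every threshold \<open>h\<close>, the total decrease is the sum of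
  \<open>min \<delta> h\<close> over the full cycles and the discharge half cycles (\<open>drained_rainflow\<close>).

  The amount that segment \<open>j\<close> alone discharges is the difference between the thresholds \<open>j / J\<close>
  and \<open>(j - 1) / J\<close>. Weighting it with \<open>c\<^sub>j\<close> and summing over \<open>j\<close> turns \<open>min \<delta> h\<close> into the value
  at \<open>\<delta>\<close> of the piecewise linear interpolation of \<open>\<Phi>\<close> at the points \<open>j / J\<close>. So for every
  \<open>J > 0\<close> the piecewise linear cost is exactly the rainflow cost of the interpolated stress
  function (\<open>pwl_cost_eq_interpolate\<close>). The cycles do not depend on \<open>J\<close>, there are finitely
  many of them, and the interpolation converges pointwise because \<open>\<Phi>\<close> is continuous.
\<close>

section \<open>The stop operator\<close>

definition stop :: "real \<Rightarrow> real \<Rightarrow> real \<Rightarrow> real" where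
  "stop h f x = max 0 (min h (f + x))"

text \<open>
  A list is an input trajectory, of which only the increments matter; \<open>f\<close> is the state at its
  first point. The total counts the decreases of the state and not its increases.
\<close>

fun drained :: "real \<Rightarrow> real \<Rightarrow> real list \<Rightarrow> real" where
  "drained h f (a # b # xs) =
     max 0 (f - stop h f (b - a)) + drained h (stop h f (b - a)) (b # xs)"
| "drained h f xs = 0"

lemma stop_nonneg: "0 \<le> stop h f x"
  by (simp add: stop_def)

lemma stop_le: "0 \<le> h \<Longrightarrow> stop h f x \<le> h"
  by (simp add: stop_def)

lemma stop_up: "f \<le> h \<Longrightarrow> 0 \<le> x \<Longrightarrow> f \<le> stop h f x"
  by (simp add: stop_def)

lemma stop_down: "0 \<le> f \<Longrightarrow> x \<le> 0 \<Longrightarrow> stop h f x \<le> f"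
  by (simp add: stop_def min_le_iff_disj)

lemma stop_zero: "0 \<le> f \<Longrightarrow> f \<le> h \<Longrightarrow> stop h f 0 = f"
  by (simp add: stop_def)

text \<open>
  For inputs of one sign only one of the two bounds can become active, and staying at a bound is
  consistent with having moved there in a single step.
\<close>

lemma stop_stop_same_direction:
  assumes "0 \<le> f" "f \<le> h" "0 \<le> x \<and> 0 \<le> y \<or> x \<le> 0 \<and> y \<le> 0"
  shows "stop h (stop h f x) y = stop h f (x + y)"
  using assms unfolding stop_def max_def min_def by (auto split: if_splits)

lemma drop_same_direction:
  assumes "0 \<le> f" "f \<le> h" "0 \<le> x \<and> 0 \<le> y \<or> x \<le> 0 \<and> y \<le> 0"
  shows "max 0 (f - stop h f x) + max 0 (stop h f x - stop h f (x + y))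
       = max 0 (f - stop h f (x + y))"
  using assms(3)
proof
  assume "0 \<le> x \<and> 0 \<le> y"
  then have "f \<le> stop h f x" "stop h f x \<le> stop h f (x + y)"
    using assms(1,2) by (simp_all add: stop_up stop_le flip: stop_stop_same_direction)
  then show ?thesis by simp
next
  assume "x \<le> 0 \<and> y \<le> 0"
  then have "stop h f x \<le> f" "stop h f (x + y) \<le> stop h f x"
    using assms(1,2) by (simp_all add: stop_down stop_nonneg flip: stop_stop_same_direction)
  then show ?thesis by simp
qed

text \<open>
  After a rise by at least \<open>- y\<close> the state is at least \<open>min (- y) h\<close>, which is therefore
  available in full for the fall that follows.
\<close>

lemma drop_after_rise:
  assumes "0 \<le> f" "0 \<le> h" "y \<le> 0" "- y \<le> x"
  shows "stop h f x - stop h (stop h f x) y = min (- y) h"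
proof -
  have "stop h f x = min h (f + x)" using assms by (simp add: stop_def)
  moreover have "stop h (min h (f + x)) y = max 0 (min h (f + x) + y)"
    using assms(3) by (simp add: stop_def min_def)
  ultimately show ?thesis using assms by (simp add: min_def max_def)
qed

text \<open>
  The reason why rainflow counting is the right bookkeeping. Consider a rise \<open>x\<close>, a fall \<open>- y\<close>
  and a rise \<open>z\<close>, the fall being the smallest. If the first rise does not reach the upper bound,
  the fall undoes a part of it and no bound matters before the last rise; if it does reach it,
  the last rise leads back there. The fall itself costs \<open>min (- y) h\<close>. Fall, rise and fall is
  the mirror image with \<open>h - f\<close> as the state; there the rise in the middle adds as much to the
  later decreases.
\<close>

lemma stop_cycle:
  assumes f: "0 \<le> f" "f \<le> h"
    and dir: "0 \<le> x \<and> y \<le> 0 \<and> 0 \<le> z \<or> x \<le> 0 \<and> 0 \<le> y \<and> z \<le> 0"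
    and dep: "\<bar>y\<bar> \<le> \<bar>x\<bar>" "\<bar>y\<bar> \<le> \<bar>z\<bar>"
  shows "stop h (stop h (stop h f x) y) z = stop h f (x + y + z)"
    and "max 0 (f - stop h f x) + max 0 (stop h f x - stop h (stop h f x) y)
       + max 0 (stop h (stop h f x) y - stop h f (x + y + z))
       = min \<bar>y\<bar> h + max 0 (f - stop h f (x + y + z))" (is ?drops)
proof -
  have "stop h (stop h (stop h f x) y) z = stop h f (x + y + z) \<and> ?drops"
    using dir
  proof
    assume "0 \<le> x \<and> y \<le> 0 \<and> 0 \<le> z"
    then have xyz: "0 \<le> x" "y \<le> 0" "0 \<le> z" "- y \<le> x" "- y \<le> z" "\<bar>y\<bar> = - y"
      using dep by auto
    define a b where "a = stop h f x" and "b = stop h a y"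
    have in_range: "0 \<le> b" "b \<le> h" using f by (simp_all add: b_def stop_nonneg stop_le)
    have a: "a = min h (f + x)"
      using f xyz(1) by (simp add: a_def stop_def)
    have b: "b = max 0 (a + y)"
      using f xyz(1,2) by (simp add: b_def stop_def a min_def)
    have closed: "stop h b z = stop h f (x + y + z)"
    proof (cases "f + x \<le> h")
      case True
      then have "b = f + x + y" using f xyz(4) by (simp add: a b)
      then show ?thesis by (simp add: stop_def add.assoc)
    next
      case False
      then have "h \<le> b + z" "h \<le> f + (x + y + z)" using f xyz(5) by (simp_all add: a b)
      then show ?thesis by (simp add: stop_def min_absorb1)
    qed
    have "a - b = min (- y) h"
      using drop_after_rise[of f h y x] f xyz(2,4) by (simp add: a_def b_def)
    moreover have "f \<le> a" "b \<le> a"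
      using f xyz(1,2) by (simp_all add: a_def b_def stop_up stop_down stop_nonneg)
    moreover have "b \<le> stop h b z" "f \<le> stop h f (x + y + z)"
      using f xyz(1-5) in_range by (simp_all add: stop_up)
    ultimately show ?thesis
      using closed xyz(6) unfolding a_def b_def by simp
  next
    assume "x \<le> 0 \<and> 0 \<le> y \<and> z \<le> 0"
    then have xyz: "x \<le> 0" "0 \<le> y" "z \<le> 0" "y \<le> - x" "y \<le> - z" "\<bar>y\<bar> = y"
      using dep by auto
    define a b where "a = stop h f x" and "b = stop h a y"
    have in_range: "0 \<le> b" "b \<le> h" using f by (simp_all add: b_def stop_nonneg stop_le)
    have a: "a = max 0 (f + x)"
      using f xyz(1) by (simp add: a_def stop_def)
    have b: "b = min h (a + y)"
      using f xyz(1,2) by (simp add: b_def stop_def a max_def)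
    have closed: "stop h b z = stop h f (x + y + z)"
    proof (cases "0 \<le> f + x")
      case True
      then have "b = f + x + y" using f xyz(4) by (simp add: a b)
      then show ?thesis by (simp add: stop_def add.assoc)
    next
      case False
      then have "b + z \<le> 0" "f + (x + y + z) \<le> 0" using f xyz(5) by (simp_all add: a b)
      then show ?thesis by (simp add: stop_def max_absorb1 min.coboundedI2)
    qed
    have "a \<le> f" "b - a = min y h" "a \<le> b"
      using f xyz(1-5) by (simp_all add: b a min_def max_def)
    moreover have "stop h b z \<le> b" "stop h f (x + y + z) \<le> f"
      using f xyz(1-5) in_range by (simp_all add: stop_down)
    ultimately show ?thesis
      using closed xyz(6) unfolding a_def b_def by simp
  qed
  then show "stop h (stop h (stop h f x) y) z = stop h f (x + y + z)" ?drops
    by simp_all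
qed

section \<open>Reduction to the local extrema\<close>

text \<open>
  Consecutive points may be equal only in a list of two points, where there is no direction to
  compare with.
\<close>

fun zigzag :: "real list \<Rightarrow> bool" where
  "zigzag (a # b # c # xs) \<longleftrightarrow> (a < b \<and> c < b \<or> b < a \<and> b < c) \<and> zigzag (b # c # xs)"
| "zigzag xs \<longleftrightarrow> True"

lemma drained_remdups_adj:
  "0 \<le> f \<Longrightarrow> f \<le> h \<Longrightarrow> drained h f (remdups_adj xs) = drained h f xs"
proof (induction xs arbitrary: f rule: remdups_adj.induct)
  case (3 x y xs)
  show ?case
  proof (cases "x = y")
    case True
    then show ?thesis using 3 by (simp add: stop_zero)
  next
    case False
    have "drained h (stop h f (y - x)) (remdups_adj (y # xs))
        = drained h (stop h f (y - x)) (y # xs)"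
      using 3(2)[OF False, of "stop h f (y - x)"] 3(3,4) stop_nonneg stop_le by simp
    moreover obtain zs where "remdups_adj (y # xs) = y # zs"
      by (metis remdups_adj_Cons')
    ultimately show ?thesis
      using False by simp
  qed
qed simp_all

text \<open>
  Dropping points moves the second point away from the first, so the direction of the first step
  persists. This is what carries alternation across a recursive call.
\<close>

lemma drop_intermediate_Cons:
  "\<exists>b' zs. drop_intermediate (a # b # xs) = a # b' # zs
           \<and> (a < b \<longrightarrow> a < b') \<and> (b < a \<longrightarrow> b' < a)"
proof (induction "a # b # xs" arbitrary: a b xs rule: drop_intermediate.induct)
  case (1 a b c xs)
  then show ?case
    by (cases "(a < b \<and> b < c) \<or> (a > b \<and> b > c)") (fastforce+)
qed auto

lemma zigzag_drop_intermediate: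
  "distinct_adj xs \<Longrightarrow> zigzag (drop_intermediate xs)"
proof (induction xs rule: drop_intermediate.induct)
  case (1 a b c xs)
  show ?case
  proof (cases "(a < b \<and> b < c) \<or> (a > b \<and> b > c)")
    case True
    then have "distinct_adj (a # c # xs)" using 1(3) by auto
    then show ?thesis using True 1(1) by simp
  next
    case False
    obtain c' zs where c': "drop_intermediate (b # c # xs) = b # c' # zs"
        "b < c \<longrightarrow> b < c'" "c < b \<longrightarrow> c' < b"
      using drop_intermediate_Cons by blast
    have "zigzag (b # c' # zs)" using 1(2)[OF False] 1(3) c'(1) by simp
    moreover have "a \<noteq> b" "b \<noteq> c" using 1(3) by auto
    ultimately show ?thesis using False c' by auto
  qed
qed auto

lemma drained_drop_intermediate:
  "0 \<le> f \<Longrightarrow> f \<le> h \<Longrightarrow> drained h f (drop_intermediate xs) = drained h f xs"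
proof (induction xs arbitrary: f rule: drop_intermediate.induct)
  case (1 a b c xs)
  show ?case
  proof (cases "(a < b \<and> b < c) \<or> (a > b \<and> b > c)")
    case True
    then have dir: "0 \<le> b - a \<and> 0 \<le> c - b \<or> b - a \<le> 0 \<and> c - b \<le> 0" by auto
    show ?thesis
      using True 1 stop_stop_same_direction[OF 1(3,4) dir] drop_same_direction[OF 1(3,4) dir]
      by simp
  next
    case False
    obtain c' zs where c': "drop_intermediate (b # c # xs) = b # c' # zs"
      using drop_intermediate_Cons by blast
    have "drained h (stop h f (b - a)) (drop_intermediate (b # c # xs))
        = drained h (stop h f (b - a)) (b # c # xs)"
      using 1(2)[OF False] stop_nonneg stop_le 1(3,4) by simp
    moreover have "drop_intermediate (a # b # c # xs) = a # b # c' # zs"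
      using False c' by (simp only: drop_intermediate.simps if_False)
    ultimately show ?thesis using c' by simp
  qed
qed simp_all

lemma set_drop_intermediate: "set (drop_intermediate xs) \<subseteq> set xs"
  by (induction xs rule: drop_intermediate.induct) auto

lemma hd_drop_intermediate: "hd (drop_intermediate xs) = hd xs"
  by (induction xs rule: drop_intermediate.induct) auto

lemma hd_local_extrema: "hd (local_extrema xs) = hd xs"
  by (simp add: local_extrema_def hd_drop_intermediate)

lemma set_local_extrema: "set (local_extrema xs) \<subseteq> set xs"
  using set_drop_intermediate[of "remdups_adj xs"] by (simp add: local_extrema_def)

lemma zigzag_local_extrema: "zigzag (local_extrema xs)"
  by (simp add: local_extrema_def zigzag_drop_intermediate)

lemma drained_local_extrema:
  "0 \<le> f \<Longrightarrow> f \<le> h \<Longrightarrow> drained h f (local_extrema xs) = drained h f xs"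
  by (simp add: local_extrema_def drained_drop_intermediate drained_remdups_adj)

section \<open>Removing full cycles\<close>

text \<open>
  The enclosing steps are at least as deep as the removed one, so their sum keeps their direction
  and remains nonzero.
\<close>

lemma zigzag_remove_cycle:
  assumes "zigzag (s0 # s1 # s2 # s3 # xs)"
    and "\<bar>s1 - s2\<bar> \<le> \<bar>s0 - s1\<bar>" "\<bar>s1 - s2\<bar> \<le> \<bar>s2 - s3\<bar>"
  shows "zigzag (s0 # s3 # xs)" "s0 < s1 \<longrightarrow> s0 < s3" "s1 < s0 \<longrightarrow> s3 < s0"
  using assms by (cases xs; auto)+

lemma drained_remove_cycle:
  assumes f: "0 \<le> f" "f \<le> h"
    and zz: "zigzag (s0 # s1 # s2 # s3 # xs)"
    and dep: "\<bar>s1 - s2\<bar> \<le> \<bar>s0 - s1\<bar>" "\<bar>s1 - s2\<bar> \<le> \<bar>s2 - s3\<bar>"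
  shows "drained h f (s0 # s1 # s2 # s3 # xs)
       = min \<bar>s1 - s2\<bar> h + drained h f (s0 # s3 # xs)"
proof -
  have dir: "0 \<le> s1 - s0 \<and> s2 - s1 \<le> 0 \<and> 0 \<le> s3 - s2
           \<or> s1 - s0 \<le> 0 \<and> 0 \<le> s2 - s1 \<and> s3 - s2 \<le> 0"
    using zz by auto
  have dep': "\<bar>s2 - s1\<bar> \<le> \<bar>s1 - s0\<bar>" "\<bar>s2 - s1\<bar> \<le> \<bar>s3 - s2\<bar>" using dep by auto
  have sum: "s1 - s0 + (s2 - s1) + (s3 - s2) = s3 - s0" by simp
  note state = stop_cycle(1)[OF f dir dep', unfolded sum]
    and drop = stop_cycle(2)[OF f dir dep', unfolded sum]
  show ?thesis
    unfolding drained.simps state abs_minus_commute[of s1 s2]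
    by (simp only: drop[symmetric] add.assoc[symmetric])
qed

text \<open>
  The claim on the second point is there for the induction: when the pass shifts forward, the
  skipped point \<open>s0\<close> is put back in front of the processed list and must still alternate with it.
\<close>

lemma rainflow_pass_zigzag:
  "zigzag xs \<Longrightarrow> zigzag (snd (rainflow_pass xs))
     \<and> (\<forall>a b ys. xs = a # b # ys \<longrightarrow>
          (\<exists>b' zs. snd (rainflow_pass xs) = a # b' # zs
                   \<and> (a < b \<longrightarrow> a < b') \<and> (b < a \<longrightarrow> b' < a)))"
proof (induction xs rule: rainflow_pass.induct)
  case (1 s0 s1 s2 s3 xs)
  show ?case
  proof (cases "\<bar>s1 - s2\<bar> \<le> \<bar>s0 - s1\<bar> \<and> \<bar>s1 - s2\<bar> \<le> \<bar>s2 - s3\<bar>")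
    case True
    have "\<exists>b' zs. snd (rainflow_pass (s0 # s3 # xs)) = s0 # b' # zs
                   \<and> (s0 < s3 \<longrightarrow> s0 < b') \<and> (s3 < s0 \<longrightarrow> b' < s0)"
      and "zigzag (snd (rainflow_pass (s0 # s3 # xs)))"
      using 1(1)[OF True] zigzag_remove_cycle(1)[OF 1(3)] True by blast+
    then show ?thesis
      using zigzag_remove_cycle(2,3)[OF 1(3)] True
      by (auto split: prod.splits)
  next
    case False
    have zz: "zigzag (s1 # s2 # s3 # xs)" using 1(3) by simp
    obtain b' zs where b': "snd (rainflow_pass (s1 # s2 # s3 # xs)) = s1 # b' # zs"
        "s1 < s2 \<longrightarrow> s1 < b'" "s2 < s1 \<longrightarrow> b' < s1"
      using 1(2)[OF False zz] by blast
    have "zigzag (s1 # b' # zs)" using 1(2)[OF False zz] b'(1) by simp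
    then show ?thesis
      using False b' 1(3) by (auto split: prod.splits)
  qed
qed auto

lemma drained_rainflow_pass:
  "\<lbrakk>zigzag xs; 0 \<le> f; f \<le> h\<rbrakk> \<Longrightarrow> drained h f xs
     = (\<Sum>\<delta>\<leftarrow>fst (rainflow_pass xs). min \<delta> h) + drained h f (snd (rainflow_pass xs))"
proof (induction xs arbitrary: f rule: rainflow_pass.induct)
  case (1 s0 s1 s2 s3 xs)
  show ?case
  proof (cases "\<bar>s1 - s2\<bar> \<le> \<bar>s0 - s1\<bar> \<and> \<bar>s1 - s2\<bar> \<le> \<bar>s2 - s3\<bar>")
    case True
    then have dep: "\<bar>s1 - s2\<bar> \<le> \<bar>s0 - s1\<bar>" "\<bar>s1 - s2\<bar> \<le> \<bar>s2 - s3\<bar>" by auto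
    have IH: "drained h f (s0 # s3 # xs) = (\<Sum>\<delta>\<leftarrow>fst (rainflow_pass (s0 # s3 # xs)). min \<delta> h)
        + drained h f (snd (rainflow_pass (s0 # s3 # xs)))"
      using 1(1)[OF True zigzag_remove_cycle(1)[OF 1(3) dep] 1(4,5)] .
    show ?thesis
      unfolding drained_remove_cycle[OF 1(4,5,3) dep]
      using IH True by (simp split: prod.splits)
  next
    case False
    have zz: "zigzag (s1 # s2 # s3 # xs)" using 1(3) by simp
    obtain b' zs where b': "snd (rainflow_pass (s1 # s2 # s3 # xs)) = s1 # b' # zs"
      using rainflow_pass_zigzag[OF zz] by blast
    define f' where "f' = stop h f (s1 - s0)"
    have "0 \<le> f'" "f' \<le> h" using 1(4,5) by (auto simp: f'_def stop_nonneg stop_le)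
    note IH = 1(2)[OF False zz this]
    have "rainflow_pass (s0 # s1 # s2 # s3 # xs)
        = (fst (rainflow_pass (s1 # s2 # s3 # xs)), s0 # s1 # b' # zs)"
      using False b' by (simp only: rainflow_pass.simps if_False case_prod_beta Let_def)
    then show ?thesis
      using IH unfolding b' by (simp add: f'_def)
  qed
qed simp_all

lemma set_rainflow_pass: "set (snd (rainflow_pass xs)) \<subseteq> set xs"
  by (induction xs rule: rainflow_pass.induct) (auto split: prod.splits)

lemma hd_rainflow_pass: "hd (snd (rainflow_pass xs)) = hd xs"
  by (induction xs rule: rainflow_pass.induct) (auto split: prod.splits)

lemma depths_rainflow_pass:
  "set xs \<subseteq> {0..1} \<Longrightarrow> set (fst (rainflow_pass xs)) \<subseteq> {0..1}"
proof (induction xs rule: rainflow_pass.induct)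
  case (1 s0 s1 s2 s3 xs)
  show ?case
  proof (cases "\<bar>s1 - s2\<bar> \<le> \<bar>s0 - s1\<bar> \<and> \<bar>s1 - s2\<bar> \<le> \<bar>s2 - s3\<bar>")
    case True
    moreover have "\<bar>s1 - s2\<bar> \<in> {0..1}" using 1(3) by auto
    ultimately show ?thesis using 1(1)[OF True] 1(3) by (simp add: case_prod_beta Let_def)
  next
    case False
    then show ?thesis using 1(2)[OF False] 1(3) by (auto simp: case_prod_beta Let_def)
  qed
qed simp_all

text \<open>
  The last pass changes nothing, so a residue is a list on which a pass finds nothing. This is how the absence of four points
  that form a cycle is expressed from here on.
\<close>

lemma rainflow_pass_no_cycle: "fst (rainflow_pass xs) = [] \<Longrightarrow> snd (rainflow_pass xs) = xs"
  by (induction xs rule: rainflow_pass.induct) (auto split: prod.splits if_splits)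

lemma rainflow_decomposition:
  "\<lbrakk>zigzag xs; set xs \<subseteq> {0..1}\<rbrakk> \<Longrightarrow>
     zigzag (snd (rainflow xs)) \<and> fst (rainflow_pass (snd (rainflow xs))) = []
     \<and> set (snd (rainflow xs)) \<subseteq> {0..1} \<and> set (fst (rainflow xs)) \<subseteq> {0..1}
     \<and> hd (snd (rainflow xs)) = hd xs
     \<and> (\<forall>f h. 0 \<le> f \<longrightarrow> f \<le> h \<longrightarrow> drained h f xs
          = (\<Sum>\<delta>\<leftarrow>fst (rainflow xs). min \<delta> h) + drained h f (snd (rainflow xs)))"
proof (induction xs rule: rainflow.induct)
  case (1 xs)
  obtain cs rest where p: "rainflow_pass xs = (cs, rest)" by fastforce
  show ?case
  proof (cases "cs = []")
    case True
    then have "rest = xs" using p rainflow_pass_no_cycle[of xs] by simp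
    then show ?thesis using True p 1(2,3) by (simp add: rainflow.simps[of xs])
  next
    case False
    obtain cs' residue where r: "rainflow rest = (cs', residue)" by fastforce
    have rest: "zigzag rest" "set rest \<subseteq> {0..1}" "hd rest = hd xs"
      using rainflow_pass_zigzag[OF 1(2)] set_rainflow_pass[of xs] hd_rainflow_pass[of xs] 1(3) p
      by auto
    have cs: "set cs \<subseteq> {0..1}" using depths_rainflow_pass[OF 1(3)] p by simp
    have "drained h f xs = (\<Sum>\<delta>\<leftarrow>cs. min \<delta> h) + drained h f rest" if "0 \<le> f" "f \<le> h" for f h
      using drained_rainflow_pass[OF 1(2) that] p by simp
    with 1(1)[OF p[symmetric] refl False rest(1,2)] rest(3) cs False p r show ?thesis
      by (simp add: rainflow.simps[of xs])
  qed
qed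

section \<open>The rainflow residue\<close>

abbreviation half_cycle_drop :: "real \<Rightarrow> real list \<Rightarrow> real" where
  "half_cycle_drop h r \<equiv> (\<Sum>\<delta>\<leftarrow>discharge_half_cycles r. min \<delta> h)"

lemma half_cycle_drop_Cons:
  "half_cycle_drop h (a # b # xs) = (if b < a then min (a - b) h else 0) + half_cycle_drop h (b # xs)"
  by (simp add: discharge_half_cycles_def)

lemma half_cycle_drop_short: "half_cycle_drop h [] = 0" "half_cycle_drop h [a] = 0"
  by (simp_all add: discharge_half_cycles_def)

lemma depths_discharge_half_cycles:
  "set r \<subseteq> {0..1} \<Longrightarrow> set (discharge_half_cycles r) \<subseteq> {0..1}"
proof (induction r rule: induct_list012)
  case (3 a b r)
  then show ?case by (auto simp: discharge_half_cycles_def)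
qed (auto simp: discharge_half_cycles_def)

lemma no_cycle_tl:
  "fst (rainflow_pass (a # xs)) = [] \<Longrightarrow> fst (rainflow_pass xs) = []"
  by (cases "a # xs" rule: rainflow_pass.cases) (auto split: prod.splits if_splits)

lemma zigzag_tl: "zigzag (a # xs) \<Longrightarrow> zigzag xs"
  by (cases "a # xs" rule: zigzag.cases) auto

text \<open>
  A step at most as deep as the step before it, in the opposite direction: if it is a discharge,
  the preceding charge has already provided the \<open>min (a - b) h\<close> that it takes.
\<close>

lemma drop_at_turn:
  assumes "0 \<le> f" "f \<le> h" "p < a \<and> b < a \<or> a < p \<and> a < b" "\<bar>a - b\<bar> \<le> \<bar>p - a\<bar>"
  shows "max 0 (stop h f (a - p) - stop h (stop h f (a - p)) (b - a))
       = (if b < a then min (a - b) h else 0)"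
  using assms(3)
proof
  assume "p < a \<and> b < a"
  then show ?thesis
    using drop_after_rise[of f h "b - a" "a - p"] assms by simp
next
  assume "a < p \<and> a < b"
  then show ?thesis
    using stop_up[of "stop h f (a - p)" h "b - a"] assms by (simp add: stop_le)
qed

text \<open>
  Once a step of a residue is at most as deep as its predecessor, all later steps shrink: if
  \<open>\<bar>a - b\<bar> \<le> \<bar>p - a\<bar>\<close> and \<open>p, a, b, c\<close> do not form a cycle, then \<open>\<bar>b - c\<bar> < \<bar>a - b\<bar>\<close>. Every
  discharge then takes back a part of the charge right before it.
\<close>

lemma drained_contracting:
  assumes "zigzag (p # a # b # xs)" "fst (rainflow_pass (p # a # b # xs)) = []"
    and "\<bar>a - b\<bar> \<le> \<bar>p - a\<bar>" "0 \<le> f" "f \<le> h"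
  shows "drained h (stop h f (a - p)) (a # b # xs) = half_cycle_drop h (a # b # xs)"
  using assms
proof (induction xs arbitrary: p a b f)
  case Nil
  then show ?case
    using drop_at_turn[of f h p a b] by (simp add: half_cycle_drop_Cons half_cycle_drop_short)
next
  case (Cons c xs)
  have "\<not> \<bar>a - b\<bar> \<le> \<bar>b - c\<bar>"
    using Cons.prems(2,3) by (auto split: prod.splits)
  moreover have "0 \<le> stop h f (a - p)" "stop h f (a - p) \<le> h"
    using Cons.prems(4,5) by (auto simp: stop_nonneg stop_le)
  ultimately have IH: "drained h (stop h (stop h f (a - p)) (b - a)) (b # c # xs)
      = half_cycle_drop h (b # c # xs)"
    using Cons.prems(1) no_cycle_tl[OF Cons.prems(2)]
    by (intro Cons.IH) auto
  have "p < a \<and> b < a \<or> a < p \<and> a < b"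
    using Cons.prems(1) by simp
  with IH show ?case
    using drop_at_turn[of f h p a b] Cons.prems(3-5)
    unfolding half_cycle_drop_Cons[of h a b "c # xs"] by simp
qed

text \<open>
  The state \<open>min s h\<close> means that the energy occupies the lowest depths without a gap. A fall to
  \<open>a\<close> empties depths from below, and a rise back to at least \<open>s\<close> fills them again.
\<close>

lemma stop_refill:
  assumes "0 \<le> a" "a \<le> s" "s \<le> b" "0 \<le> h"
  shows "stop h (stop h (min s h) (a - s)) (b - a) = min b h"
proof (cases "s \<le> h")
  case True
  then have "stop h (min s h) (a - s) = a" using assms by (simp add: stop_def)
  then show ?thesis using assms by (simp add: stop_def min.commute)
next
  case False
  then have "stop h (min s h) (a - s) = max 0 (h + (a - s))"
    using assms by (simp add: stop_def min_absorb2)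
  moreover have "h \<le> max 0 (h + (a - s)) + (b - a)"
    using assms by simp
  ultimately show ?thesis using assms False by (simp add: stop_def min_absorb1 min_absorb2)
qed

text \<open>
  While the depths grow, the state is gapless (\<open>min s h\<close>) at each maximum by \<open>stop_refill\<close>, so
  that a discharge from there to \<open>a\<close> decreases it by \<open>min (s - a) h\<close>; here \<open>a \<ge> 0\<close> enters. When
  the depths stop growing, \<open>drained_contracting\<close> takes over.
\<close>

lemma drained_residue:
  assumes "zigzag (s # xs)" "fst (rainflow_pass (s # xs)) = []" "set (s # xs) \<subseteq> {0..}" "0 \<le> h"
  shows "drained h (min s h) (s # xs) = half_cycle_drop h (s # xs)"
  using assms
proof (induction "length xs" arbitrary: s xs rule: less_induct)
  case less
  show ?case
  proof (cases xs)
    case Nil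
    then show ?thesis by (simp add: half_cycle_drop_short)
  next
    case (Cons a ys)
    have nn: "0 \<le> s" "0 \<le> a" using less.prems Cons by auto
    have zz: "zigzag (a # ys)" and nc: "fst (rainflow_pass (a # ys)) = []"
      using zigzag_tl no_cycle_tl less.prems Cons by blast+
    have first: "max 0 (min s h - stop h (min s h) (a - s)) = (if a < s then min (s - a) h else 0)"
      using nn less.prems(4) by (auto simp: stop_def max_def min_def)
    show ?thesis
    proof (cases "s \<le> a")
      case True
      then have "stop h (min s h) (a - s) = min a h"
        using nn less.prems(4) by (auto simp: stop_def max_def min_def)
      then show ?thesis
        using less.hyps[of ys a] zz nc less.prems(3,4) first
        unfolding Cons half_cycle_drop_Cons by simp
    next
      case down: False
      show ?thesis
      proof (cases ys)
        case Nil
        then show ?thesis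
          using first unfolding Cons Nil half_cycle_drop_Cons half_cycle_drop_short by simp
      next
        case Cons': (Cons b zs)
        show ?thesis
        proof (cases "\<bar>a - b\<bar> \<le> \<bar>s - a\<bar>")
          case True
          have "drained h (stop h (min s h) (a - s)) (a # b # zs) = half_cycle_drop h (a # b # zs)"
            using less.prems True nn unfolding Cons Cons'
            by (intro drained_contracting) auto
          then show ?thesis
            using first unfolding Cons Cons' half_cycle_drop_Cons[of h s] by simp
        next
          case False
          have up: "a < b" using less.prems(1) down Cons Cons' by auto
          \<comment> \<open>The rise exceeds the fall before it, so the state at \<open>b\<close> is gapless again.\<close>
          have full: "stop h (stop h (min s h) (a - s)) (b - a) = min b h"
            using nn less.prems(4) down up False by (intro stop_refill) simp_all
          have "stop h (min s h) (a - s) \<le> min s h"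
            using nn less.prems(4) down by (intro stop_down) simp_all
          also have "\<dots> \<le> min b h"
            using down up False by (intro min.mono) simp_all
          finally have second: "max 0 (stop h (min s h) (a - s) - min b h) = 0" by simp
          have "drained h (min b h) (b # zs) = half_cycle_drop h (b # zs)"
            using less.hyps[of zs b] zigzag_tl[of a] no_cycle_tl[of a] zz nc less.prems(3,4) Cons Cons'
            by auto
          then show ?thesis
            using first second full up unfolding Cons Cons' half_cycle_drop_Cons by simp
        qed
      qed
    qed
  qed
qed

text \<open>
  The initial state \<open>min (hd xs) h\<close> is the gapless one, which corresponds to the initial
  distribution of the energy over the segments from the lowest upwards.
\<close>

lemma drained_rainflow:
  assumes "xs \<noteq> []" "set xs \<subseteq> {0..1}" "0 \<le> h" "rainflow (local_extrema xs) = (full, residue)"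
  shows "drained h (min (hd xs) h) xs
       = (\<Sum>\<delta>\<leftarrow>full @ discharge_half_cycles residue. min \<delta> h)"
    and "set (full @ discharge_half_cycles residue) \<subseteq> {0..1}"
proof -
  have sub: "set (local_extrema xs) \<subseteq> {0..1}" using set_local_extrema assms(2) by blast
  note R = rainflow_decomposition[OF zigzag_local_extrema sub, unfolded assms(4) fst_conv snd_conv hd_local_extrema]
  have f: "0 \<le> min (hd xs) h" "min (hd xs) h \<le> h"
    using assms(1-3) by (cases xs; auto)+
  have res: "drained h (min (hd xs) h) residue = half_cycle_drop h residue"
  proof (cases residue)
    case Nil
    then show ?thesis by (simp add: half_cycle_drop_short)
  next
    case (Cons s ys)
    have "drained h (min s h) (s # ys) = half_cycle_drop h (s # ys)"
      using R Cons assms(3) by (intro drained_residue) auto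
    then show ?thesis using R Cons by simp
  qed
  show "drained h (min (hd xs) h) xs = (\<Sum>\<delta>\<leftarrow>full @ discharge_half_cycles residue. min \<delta> h)"
    using R f res drained_local_extrema[OF f, of xs] by simp
  show "set (full @ discharge_half_cycles residue) \<subseteq> {0..1}"
    using R depths_discharge_half_cycles[of residue] by simp
qed

section \<open>The segments as stop operators\<close>

text \<open>
  The greedy recursion has a closed form for its partial sums. It is the step from the vector of
  segments to scalar recursions.
\<close>

lemma sum_distribute:
  assumes "0 \<le> x" "\<And>j. 0 \<le> cap j"
  shows "(\<Sum>j\<in>{1..k}. distribute x cap j) = min x (\<Sum>j\<in>{1..k}. cap j)"
proof (induction k)
  case (Suc k)
  have "{1..<Suc k} = {1..k}" by auto
  then have "distribute x cap (Suc k) = min (x - min x (\<Sum>j\<in>{1..k}. cap j)) (cap (Suc k))"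
    using Suc by (subst distribute.simps) simp
  with Suc assms(2)[of "Suc k"] show ?case by (simp add: min_def)
qed (use assms in simp)

lemma distribute_bounds:
  assumes "0 \<le> x" "\<And>j. 0 \<le> cap j"
  shows "0 \<le> distribute x cap j" "distribute x cap j \<le> cap j"
proof -
  have "{1..<j} = {1..j - 1}" by auto
  then show "0 \<le> distribute x cap j" "distribute x cap j \<le> cap j"
    using sum_distribute[OF assms, where k = "j - 1"] assms(2)[of j]
    by (auto simp: distribute.simps[of x cap j])
qed

lemma distribute_zero:
  assumes "\<And>j. 0 \<le> cap j"
  shows "distribute 0 cap j = 0"
proof -
  have "{1..<j} = {1..j - 1}" by auto
  then have "distribute 0 cap j = min (0 - min 0 (\<Sum>i\<in>{1..j - 1}. cap i)) (cap j)"
    using sum_distribute[OF order_refl assms, where k = "j - 1"] by (subst distribute.simps) simp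
  then show ?thesis using assms by (simp add: sum_nonneg min_absorb1)
qed

lemma initial_segment_energy_bounds:
  assumes "0 \<le> segment_capacity B J"
  shows "0 \<le> initial_segment_energy B J e0 j"
    "initial_segment_energy B J e0 j \<le> segment_capacity B J"
  using assms by (auto simp: initial_segment_energy.simps[of B J e0 j])

lemma sum_initial_segment_energy:
  assumes "0 \<le> segment_capacity B J" "0 \<le> e0"
  shows "(\<Sum>j\<in>{1..k}. initial_segment_energy B J e0 j) = min e0 (real k * segment_capacity B J)"
proof (induction k)
  case (Suc k)
  have "{1..<Suc k} = {1..k}" by auto
  then have "initial_segment_energy B J e0 (Suc k)
      = min (segment_capacity B J) (max 0 (e0 - min e0 (real k * segment_capacity B J)))"
    using Suc by (subst initial_segment_energy.simps) simp
  with Suc assms show ?case by (simp add: min_def max_def algebra_simps)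
qed (use assms in simp)

text \<open>
  The next two facts bring a charge \<open>u\<close> or a discharge \<open>w\<close>, each limited by the space or the
  energy that is there, into the form of a stop operator with a signed input. At most one of
  \<open>u\<close> and \<open>w\<close> is nonzero, so the order of charging and discharging is immaterial.
\<close>

lemma fill_eq_stop:
  assumes "0 \<le> f" "f \<le> h" "u = 0 \<and> 0 \<le> w \<or> w = 0 \<and> 0 \<le> u"
  shows "f + min u (h - f) - min w f = stop h f (u - w)"
  using assms(3)
proof
  assume "u = 0 \<and> 0 \<le> w"
  then show ?thesis using assms(1,2) by (simp add: stop_def min_absorb1)
next
  assume "w = 0 \<and> 0 \<le> u"
  then show ?thesis using assms(1,2) by (simp add: stop_def min_absorb1 min_def)
qed

lemma drop_fill:
  assumes "0 \<le> (f :: real)" "f \<le> h" "u = 0 \<and> 0 \<le> w \<or> w = 0 \<and> 0 \<le> u"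
  shows "max 0 (f - (f + min u (h - f) - min w f)) = min w f"
  using assms(3)
proof
  assume "u = 0 \<and> 0 \<le> w"
  then show ?thesis using assms(1,2) by (simp add: min_absorb1)
next
  assume "w = 0 \<and> 0 \<le> u"
  then show ?thesis using assms(1,2) by (simp add: min_absorb1)
qed

locale segmented_battery =
  fixes B :: battery and J :: nat and e0 :: real and d g :: "nat \<Rightarrow> real"
  assumes battery: "valid_battery B"
    and J_pos: "0 < J"
    and dispatch: "(d, g) \<in> feasible_dispatches B e0"
    and e0_nonneg: "0 \<le> e0"
begin

abbreviation "\<epsilon> \<equiv> segment_energy B J e0 d g"

text \<open>
  Measuring the first \<open>k\<close> segments in units of the rated energy makes the capacity \<open>k / J\<close> and
  the inputs differences of states of charge.
\<close>

definition filled :: "nat \<Rightarrow> nat \<Rightarrow> real" where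
  "filled t k = (\<Sum>j\<in>{1..k}. \<epsilon> t j) / E_rate B"

abbreviation "soc t \<equiv> energy_level B e0 d g t / E_rate B"

lemma params: "0 < interval B" "0 < E_rate B" "0 < eta_ch B" "0 < eta_dis B"
  using battery by (auto simp: valid_battery_def)

lemma capacity_nonneg: "0 \<le> segment_capacity B J"
  using params by (simp add: segment_capacity_def)

lemma one_direction:
  assumes "t \<in> {1..horizon B}"
  shows "d t = 0 \<and> 0 \<le> g t \<or> g t = 0 \<and> 0 \<le> d t"
proof -
  obtain v :: "nat \<Rightarrow> real" where "\<forall>t\<in>{1..horizon B}. v t \<in> {0, 1}
      \<and> 0 \<le> d t \<and> d t \<le> charge_limit B * (1 - v t) \<and> 0 \<le> g t \<and> g t \<le> discharge_limit B * v t"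
    using dispatch unfolding feasible_dispatches_def by blast
  from bspec[OF this assms] show ?thesis by auto
qed

lemma charge_cap_nonneg:
  assumes "\<And>j. \<epsilon>' j \<le> segment_capacity B J"
  shows "0 \<le> (segment_capacity B J - \<epsilon>' j) / (eta_ch B * interval B)"
  using assms[of j] params by simp

lemma discharge_cap_nonneg:
  assumes "\<And>j. 0 \<le> \<epsilon>' j"
  shows "0 \<le> eta_dis B * \<epsilon>' j / interval B"
  using assms[of j] params by simp

lemma sum_charge_split:
  assumes "0 \<le> x" "\<And>j. \<epsilon>' j \<le> segment_capacity B J"
  shows "interval B * eta_ch B * (\<Sum>j\<in>{1..k}. charge_split B J x \<epsilon>' j)
       = min (interval B * eta_ch B * x) (real k * segment_capacity B J - (\<Sum>j\<in>{1..k}. \<epsilon>' j))"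
proof -
  have "(\<Sum>j\<in>{1..k}. (segment_capacity B J - \<epsilon>' j) / (eta_ch B * interval B))
      = (real k * segment_capacity B J - (\<Sum>j\<in>{1..k}. \<epsilon>' j)) / (interval B * eta_ch B)"
    by (simp add: sum_divide_distrib[symmetric] sum_subtractf mult.commute)
  then have "(\<Sum>j\<in>{1..k}. charge_split B J x \<epsilon>' j)
      = min x ((real k * segment_capacity B J - (\<Sum>j\<in>{1..k}. \<epsilon>' j)) / (interval B * eta_ch B))"
    unfolding charge_split_def
    using sum_distribute[OF assms(1), of "\<lambda>j. (segment_capacity B J - \<epsilon>' j) / (eta_ch B * interval B)" k]
      charge_cap_nonneg[of \<epsilon>', OF assms(2)] by simp
  then show ?thesis
    using params by (simp add: min_mult_distrib_left)
qed

lemma sum_discharge_split: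
  assumes "0 \<le> x" "\<And>j. 0 \<le> \<epsilon>' j"
  shows "interval B / eta_dis B * (\<Sum>j\<in>{1..k}. discharge_split B x \<epsilon>' j)
       = min (interval B / eta_dis B * x) (\<Sum>j\<in>{1..k}. \<epsilon>' j)"
proof -
  have "(\<Sum>j\<in>{1..k}. eta_dis B * \<epsilon>' j / interval B)
      = (\<Sum>j\<in>{1..k}. \<epsilon>' j) / (interval B / eta_dis B)"
    by (simp add: sum_divide_distrib[symmetric] sum_distrib_left[symmetric] mult.commute)
  then have "(\<Sum>j\<in>{1..k}. discharge_split B x \<epsilon>' j)
      = min x ((\<Sum>j\<in>{1..k}. \<epsilon>' j) / (interval B / eta_dis B))"
    unfolding discharge_split_def
    using sum_distribute[OF assms(1), of "\<lambda>j. eta_dis B * \<epsilon>' j / interval B" k]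
      discharge_cap_nonneg[of \<epsilon>', OF assms(2)] by simp
  then show ?thesis
    using params by (simp add: min_mult_distrib_left)
qed

lemma charge_split_bounds:
  assumes "0 \<le> x" "\<And>j. \<epsilon>' j \<le> segment_capacity B J"
  shows "0 \<le> interval B * eta_ch B * charge_split B J x \<epsilon>' j"
    "interval B * eta_ch B * charge_split B J x \<epsilon>' j \<le> segment_capacity B J - \<epsilon>' j"
proof -
  note bounds = distribute_bounds[OF assms(1) charge_cap_nonneg[of \<epsilon>', OF assms(2)],
      folded charge_split_def]
  show "0 \<le> interval B * eta_ch B * charge_split B J x \<epsilon>' j"
    using bounds(1)[where j = j] params by simp
  have "interval B * eta_ch B * charge_split B J x \<epsilon>' j
      \<le> interval B * eta_ch B * ((segment_capacity B J - \<epsilon>' j) / (eta_ch B * interval B))"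
    using bounds(2)[where j = j] params by (intro mult_left_mono) simp_all
  also have "\<dots> = segment_capacity B J - \<epsilon>' j"
    using params by simp
  finally show "interval B * eta_ch B * charge_split B J x \<epsilon>' j \<le> segment_capacity B J - \<epsilon>' j" .
qed

lemma discharge_split_bounds:
  assumes "0 \<le> x" "\<And>j. 0 \<le> \<epsilon>' j"
  shows "0 \<le> interval B / eta_dis B * discharge_split B x \<epsilon>' j"
    "interval B / eta_dis B * discharge_split B x \<epsilon>' j \<le> \<epsilon>' j"
proof -
  note bounds = distribute_bounds[OF assms(1) discharge_cap_nonneg[of \<epsilon>', OF assms(2)],
      folded discharge_split_def]
  show "0 \<le> interval B / eta_dis B * discharge_split B x \<epsilon>' j"
    using bounds(1)[where j = j] params by simp
  have "interval B / eta_dis B * discharge_split B x \<epsilon>' j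
      \<le> interval B / eta_dis B * (eta_dis B * \<epsilon>' j / interval B)"
    using bounds(2)[where j = j] params by (intro mult_left_mono) simp_all
  also have "\<dots> = \<epsilon>' j"
    using params by simp
  finally show "interval B / eta_dis B * discharge_split B x \<epsilon>' j \<le> \<epsilon>' j" .
qed

lemma segment_energy_step:
  "\<epsilon> (Suc t) j = \<epsilon> t j + interval B * eta_ch B * charge_split B J (d (Suc t)) (\<epsilon> t) j
     - interval B / eta_dis B * discharge_split B (g (Suc t)) (\<epsilon> t) j"
  by (simp add: Let_def algebra_simps)

text \<open>
  The limits on the segments are nonnegative only if every segment stays between empty and full;
  \<open>sum_distribute\<close> depends on that, so it has to be known before the partial sums.
\<close>

lemma segment_energy_bounds:
  "t \<le> horizon B \<Longrightarrow> (\<forall>j. 0 \<le> \<epsilon> t j \<and> \<epsilon> t j \<le> segment_capacity B J)"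
proof (induction t)
  case 0
  then show ?case using initial_segment_energy_bounds[OF capacity_nonneg] by simp
next
  case (Suc t)
  then have IH: "\<And>j. 0 \<le> \<epsilon> t j" "\<And>j. \<epsilon> t j \<le> segment_capacity B J" by auto
  have dir: "d (Suc t) = 0 \<and> 0 \<le> g (Suc t) \<or> g (Suc t) = 0 \<and> 0 \<le> d (Suc t)"
    using one_direction[of "Suc t"] Suc.prems by simp
  show ?case
  proof
    fix j
    have idle: "charge_split B J 0 (\<epsilon> t) j = 0" "discharge_split B 0 (\<epsilon> t) j = 0"
      unfolding charge_split_def discharge_split_def
      by (intro distribute_zero charge_cap_nonneg discharge_cap_nonneg IH)+
    from dir show "0 \<le> \<epsilon> (Suc t) j \<and> \<epsilon> (Suc t) j \<le> segment_capacity B J"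
    proof
      assume "d (Suc t) = 0 \<and> 0 \<le> g (Suc t)"
      then show ?thesis
        unfolding segment_energy_step
        using IH(2)[of j] idle discharge_split_bounds[of "g (Suc t)" "\<epsilon> t" j, OF _ IH(1)] by simp
    next
      assume "g (Suc t) = 0 \<and> 0 \<le> d (Suc t)"
      then show ?thesis
        unfolding segment_energy_step
        using IH(1)[of j] idle charge_split_bounds[of "d (Suc t)" "\<epsilon> t" j, OF _ IH(2)] by simp
    qed
  qed
qed

lemma filled_zero: "filled 0 k = min (soc 0) (real k / real J)"
proof -
  have "filled 0 k = min e0 (real k * segment_capacity B J) / E_rate B"
    using sum_initial_segment_energy[OF capacity_nonneg e0_nonneg] by (simp add: filled_def)
  also have "\<dots> = min (e0 / E_rate B) (real k * segment_capacity B J / E_rate B)"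
    using params by (simp add: min_divide_distrib_right)
  finally show ?thesis using params by (simp add: segment_capacity_def)
qed

lemma filled_bounds:
  assumes "t \<le> horizon B"
  shows "0 \<le> filled t k" "filled t k \<le> real k / real J"
proof -
  show "0 \<le> filled t k"
    using segment_energy_bounds[OF assms] params by (simp add: filled_def sum_nonneg)
  have "(\<Sum>j\<in>{1..k}. \<epsilon> t j) \<le> (\<Sum>j\<in>{1..k}. segment_capacity B J)"
    using segment_energy_bounds[OF assms] by (intro sum_mono) auto
  then show "filled t k \<le> real k / real J"
    using params J_pos by (simp add: filled_def segment_capacity_def field_simps)
qed

text \<open>
  A power that exceeds what the first \<open>k\<close> segments can take or give is passed on to the
  segments above; for the stop operator this is the clipping at its two bounds.
\<close>

lemma filled_step:
  assumes "t < horizon B"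
  shows "filled (Suc t) k = stop (real k / real J) (filled t k) (soc (Suc t) - soc t)" (is ?step)
    and "interval B / (eta_dis B * E_rate B) * (\<Sum>j\<in>{1..k}. segment_discharge B J e0 d g (Suc t) j)
       = max 0 (filled t k - filled (Suc t) k)" (is ?drop)
proof -
  let ?h = "real k / real J" and ?c = "(\<Sum>j\<in>{1..k}. charge_split B J (d (Suc t)) (\<epsilon> t) j)"
    and ?r = "(\<Sum>j\<in>{1..k}. discharge_split B (g (Suc t)) (\<epsilon> t) j)"
  define u where "u = interval B * eta_ch B * d (Suc t) / E_rate B"
  define w where "w = interval B / eta_dis B * g (Suc t) / E_rate B"
  have E: "0 < E_rate B" using params by simp
  have IH: "\<And>j. 0 \<le> \<epsilon> t j" "\<And>j. \<epsilon> t j \<le> segment_capacity B J"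
    using segment_energy_bounds[of t] assms by auto
  have dir: "d (Suc t) = 0 \<and> 0 \<le> g (Suc t) \<or> g (Suc t) = 0 \<and> 0 \<le> d (Suc t)"
    using one_direction[of "Suc t"] assms by simp
  then have nn: "0 \<le> d (Suc t)" "0 \<le> g (Suc t)" by auto
  have dir': "u = 0 \<and> 0 \<le> w \<or> w = 0 \<and> 0 \<le> u"
    using dir params by (auto simp: u_def w_def)
  have charged: "interval B * eta_ch B * ?c / E_rate B = min u (?h - filled t k)"
    unfolding sum_charge_split[of "d (Suc t)" "\<epsilon> t", OF nn(1) IH(2)] u_def
    using E by (simp add: min_divide_distrib_right filled_def segment_capacity_def diff_divide_distrib)
  have removed: "interval B / eta_dis B * ?r / E_rate B = min w (filled t k)"
    unfolding sum_discharge_split[of "g (Suc t)" "\<epsilon> t", OF nn(2) IH(1)] w_def filled_def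
    using E by (simp add: min_divide_distrib_right)
  have "filled (Suc t) k = filled t k + interval B * eta_ch B * ?c / E_rate B
      - interval B / eta_dis B * ?r / E_rate B"
    unfolding filled_def segment_energy_step sum_subtractf sum.distrib sum_distrib_left[symmetric]
    by (simp only: add_divide_distrib diff_divide_distrib)
  then have new: "filled (Suc t) k = filled t k + min u (?h - filled t k) - min w (filled t k)"
    unfolding charged removed .
  have soc: "soc (Suc t) - soc t = u - w"
    by (simp add: u_def w_def add_divide_distrib diff_divide_distrib right_diff_distrib mult_ac)
  have b: "0 \<le> filled t k" "filled t k \<le> ?h" using filled_bounds[of t k] assms by auto
  show ?step
    unfolding soc new using fill_eq_stop[OF b dir'] by simp
  have "interval B / (eta_dis B * E_rate B) * (\<Sum>j\<in>{1..k}. segment_discharge B J e0 d g (Suc t) j)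
      = min w (filled t k)"
    unfolding removed[symmetric] by (simp add: segment_discharge_def)
  also have "\<dots> = max 0 (filled t k - filled (Suc t) k)"
    unfolding new using drop_fill[OF b dir'] by simp
  finally show ?drop .
qed

lemma drained_upt:
  assumes "m + n \<le> horizon B"
  shows "drained (real k / real J) (filled m k) (map soc [m..<Suc (m + n)])
       = (\<Sum>t\<in>{m..<m + n}. max 0 (filled t k - filled (Suc t) k))"
  using assms
proof (induction n arbitrary: m)
  case (Suc n)
  let ?profile = "\<lambda>m. map soc [m..<Suc (m + n)]"
  have upt: "map soc [m..<Suc (m + Suc n)] = soc m # ?profile (Suc m)"
    and tail: "?profile (Suc m) = soc (Suc m) # map soc [Suc (Suc m)..<Suc (Suc m + n)]"
    by (simp_all add: upt_conv_Cons del: upt_Suc energy_level.simps)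
  have "drained (real k / real J) (filled (Suc m) k) (?profile (Suc m))
       = (\<Sum>t\<in>{Suc m..<Suc m + n}. max 0 (filled t k - filled (Suc t) k))"
    using Suc.IH[of "Suc m"] Suc.prems by simp
  moreover have "drained (real k / real J) (filled m k) (map soc [m..<Suc (m + Suc n)])
      = max 0 (filled m k - filled (Suc m) k)
        + drained (real k / real J) (filled (Suc m) k) (?profile (Suc m))"
    unfolding upt unfolding tail drained.simps using filled_step(1)[of m k] Suc.prems by simp
  moreover have "{m..<m + Suc n} = insert m {Suc m..<Suc m + n}" by auto
  ultimately show ?case by simp
qed simp

lemma soc_bounds: "t \<le> horizon B \<Longrightarrow> e0 \<le> E_rate B \<Longrightarrow> 0 \<le> soc t \<and> soc t \<le> 1"
proof -
  assume t: "t \<le> horizon B" and e0: "e0 \<le> E_rate B"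
  obtain e :: "nat \<Rightarrow> real" where e: "e 0 = e0" "\<forall>t\<in>{1..horizon B}.
        e t - e (t - 1) = interval B * (d t * eta_ch B - g t / eta_dis B) \<and> E_min B \<le> e t \<and> e t \<le> E_max B"
    using dispatch unfolding feasible_dispatches_def by blast
  have "t \<le> horizon B \<Longrightarrow> energy_level B e0 d g t = e t" for t
  proof (induction t)
    case (Suc t)
    then show ?case using bspec[OF e(2), of "Suc t"] by simp
  qed (use e in simp)
  moreover have "0 \<le> e t \<and> e t \<le> E_rate B"
    using t e(1) bspec[OF e(2), of t] battery e0 e0_nonneg
    by (cases t) (auto simp: valid_battery_def)
  ultimately show ?thesis using t params by simp
qed

lemma sum_segment_discharge:
  "interval B / (eta_dis B * E_rate B)
     * (\<Sum>t\<in>{1..horizon B}. \<Sum>j\<in>{1..k}. segment_discharge B J e0 d g t j)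
   = drained (real k / real J) (min (soc 0) (real k / real J)) (soc_profile B e0 d g)"
proof -
  have shift: "(\<Sum>t\<in>{1..horizon B}. F t) = (\<Sum>t\<in>{0..<horizon B}. F (Suc t))" for F :: "nat \<Rightarrow> real"
    by (simp add: sum.atLeast1_atMost_eq lessThan_atLeast0)
  have "interval B / (eta_dis B * E_rate B)
     * (\<Sum>t\<in>{1..horizon B}. \<Sum>j\<in>{1..k}. segment_discharge B J e0 d g t j)
    = (\<Sum>t\<in>{0..<horizon B}. interval B / (eta_dis B * E_rate B)
        * (\<Sum>j\<in>{1..k}. segment_discharge B J e0 d g (Suc t) j))"
    unfolding shift by (rule sum_distrib_left)
  also have "\<dots> = (\<Sum>t\<in>{0..<horizon B}. max 0 (filled t k - filled (Suc t) k))"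
    by (rule sum.cong, rule refl, rule filled_step(2)) simp
  finally show ?thesis
    using drained_upt[of 0 "horizon B" k] by (simp add: soc_profile_def filled_zero del: upt_Suc)
qed

end

section \<open>Linear interpolation\<close>

text \<open>
  The slopes of the linear interpolation of \<open>\<Phi>\<close> at the points \<open>j / J\<close>, each weighted with the
  length of the part of its segment that lies below \<open>\<delta>\<close>. In this form it is linear in the
  functions \<open>min \<delta> (j / J)\<close>, which is how the cost produces it.
\<close>

definition interpolate :: "(real \<Rightarrow> real) \<Rightarrow> nat \<Rightarrow> real \<Rightarrow> real" where
  "interpolate \<Phi> J \<delta> =
     (\<Sum>j\<in>{1..J}. real J * (\<Phi> (real j / real J) - \<Phi> ((real j - 1) / real J))
                  * (min \<delta> (real j / real J) - min \<delta> ((real j - 1) / real J)))"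

lemma interpolate_eq:
  assumes "m < J" "real m / real J \<le> \<delta>" "\<delta> \<le> real (Suc m) / real J" "\<Phi> 0 = 0"
  defines "\<theta> \<equiv> real J * \<delta> - real m"
  shows "interpolate \<Phi> J \<delta> = (1 - \<theta>) * \<Phi> (real m / real J) + \<theta> * \<Phi> (real (Suc m) / real J)"
proof -
  let ?term = "\<lambda>j. real J * (\<Phi> (real j / real J) - \<Phi> ((real j - 1) / real J))
                  * (min \<delta> (real j / real J) - min \<delta> ((real j - 1) / real J))"
  have J: "0 < real J" using assms(1) by simp
  \<comment> \<open>Complete segments telescope, the segment of \<open>\<delta>\<close> contributes a fraction, later ones nothing.\<close>
  have "(\<Sum>j\<in>{1..n}. ?term j) = (if n \<le> m then \<Phi> (real n / real J)
      else (1 - \<theta>) * \<Phi> (real m / real J) + \<theta> * \<Phi> (real (Suc m) / real J))" for n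
  proof (induction n)
    case 0
    then show ?case using assms(4) by simp
  next
    case (Suc n)
    have width: "real (Suc n) / real J - real n / real J = 1 / real J"
      and pred: "real (Suc n) - 1 = real n"
      by (simp_all flip: diff_divide_distrib)
    have step: "(\<Sum>j\<in>{1..Suc n}. ?term j) = (\<Sum>j\<in>{1..n}. ?term j) + ?term (Suc n)" by simp
    consider "Suc n \<le> m" | "n = m" | "m < n" by linarith
    then show ?case
    proof cases
      case 1
      then have "real (Suc n) / real J \<le> real m / real J" "real n / real J \<le> real m / real J"
        using J by (simp_all add: divide_right_mono)
      then have le: "real (Suc n) / real J \<le> \<delta>" "real n / real J \<le> \<delta>"
        using assms(2) by linarith+
      have new: "?term (Suc n) = \<Phi> (real (Suc n) / real J) - \<Phi> (real n / real J)"
        unfolding pred min_absorb2[OF le(1)] min_absorb2[OF le(2)] width using J by simp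
      show ?thesis unfolding step new Suc using 1 by simp
    next
      case 2
      have new: "?term (Suc n) = \<theta> * (\<Phi> (real (Suc m) / real J) - \<Phi> (real m / real J))"
        unfolding 2 pred[unfolded 2] min_absorb1[OF assms(3)] min_absorb2[OF assms(2)]
        using J by (simp add: \<theta>_def field_simps)
      show ?thesis unfolding step new Suc using 2 by (simp add: algebra_simps)
    next
      case 3
      then have "real (Suc m) / real J \<le> real n / real J" "real n / real J \<le> real (Suc n) / real J"
        using J by (simp_all add: divide_right_mono)
      then have new: "?term (Suc n) = 0"
        using assms(3) by (simp add: min_def)
      show ?thesis unfolding step new Suc using 3 by simp
    qed
  qed
  from this[of J] show ?thesis using assms(1) by (simp add: interpolate_def)
qed

text \<open>
  The interpolated value is a convex combination of the values of \<open>\<Phi>\<close> at two points within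
  \<open>1 / J\<close> of \<open>\<delta>\<close>, and balls are convex.
\<close>

lemma interpolate_tendsto:
  assumes "continuous_on {0..1} \<Phi>" "\<Phi> 0 = 0" "\<delta> \<in> {0..1}"
  shows "(\<lambda>J. interpolate \<Phi> J \<delta>) \<longlonglongrightarrow> \<Phi> \<delta>"
proof (rule LIMSEQ_I)
  fix r :: real assume r: "0 < r"
  obtain s where s: "0 < s" "\<And>x. x \<in> {0..1} \<Longrightarrow> dist x \<delta> < s \<Longrightarrow> dist (\<Phi> x) (\<Phi> \<delta>) < r"
    using assms(1,3) r unfolding continuous_on_iff by metis
  obtain N :: nat where N: "0 < N" "1 / real N < s"
    using s(1) by (metis nat_approx_posE zero_less_Suc)
  have "norm (interpolate \<Phi> J \<delta> - \<Phi> \<delta>) < r" if "N \<le> J" for J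
  proof -
    have J: "0 < real J" using N that by simp
    have "1 / real J \<le> 1 / real N" using N that by (simp add: frac_le)
    then have fine: "1 / real J < s" using N by simp
    obtain m where m: "m < J" "real m / real J \<le> \<delta>" "\<delta> \<le> real (Suc m) / real J"
    proof (cases "\<delta> = 1")
      \<comment> \<open>The floor of \<open>J \<delta>\<close> would name a segment beyond the last one.\<close>
      case True
      then show ?thesis using that[of "J - 1"] J by (simp add: of_nat_diff field_simps)
    next
      case False
      define m where "m = nat \<lfloor>real J * \<delta>\<rfloor>"
      have "0 \<le> real J * \<delta>" using assms(3) by simp
      then have m: "real m \<le> real J * \<delta>" "real J * \<delta> \<le> real m + 1" unfolding m_def by linarith+
      have "real J * \<delta> < real J" using assms(3) False J by simp
      then have "m < J" using m by linarith
      then show ?thesis using that[of m] m J by (simp add: field_simps)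
    qed
    define \<theta> where "\<theta> = real J * \<delta> - real m"
    have \<theta>: "0 \<le> \<theta>" "\<theta> \<le> 1" using m J by (simp_all add: \<theta>_def field_simps)
    have "real m / real J \<in> {0..1}" "real (Suc m) / real J \<in> {0..1}"
      using m(1) J by (simp_all add: field_simps)
    moreover have "real (Suc m) / real J = real m / real J + 1 / real J" by (simp add: add_divide_distrib)
    then have "dist (real m / real J) \<delta> < s" "dist (real (Suc m) / real J) \<delta> < s"
      using m(2,3) fine by (auto simp: dist_real_def)
    ultimately have
      "\<Phi> (real m / real J) \<in> ball (\<Phi> \<delta>) r" "\<Phi> (real (Suc m) / real J) \<in> ball (\<Phi> \<delta>) r"
      using s(2)[of "real m / real J"] s(2)[of "real (Suc m) / real J"] by (simp_all add: dist_commute)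
    then have "(1 - \<theta>) *\<^sub>R \<Phi> (real m / real J) + \<theta> *\<^sub>R \<Phi> (real (Suc m) / real J) \<in> ball (\<Phi> \<delta>) r"
      using \<theta> by (intro convexD[OF convex_ball]) auto
    then show ?thesis
      using interpolate_eq[OF m, of \<Phi>, OF assms(2)] by (simp add: \<theta>_def dist_real_def abs_minus_commute)
  qed
  then show "\<exists>N. \<forall>J\<ge>N. norm (interpolate \<Phi> J \<delta> - \<Phi> \<delta>) < r" by blast
qed

section \<open>Convergence of the costs\<close>

lemma sum_mult_sum_list:
  fixes c :: "'b \<Rightarrow> 'c::semiring_0"
  shows "(\<Sum>j\<in>A. c j * (\<Sum>x\<leftarrow>xs. F j x)) = (\<Sum>x\<leftarrow>xs. \<Sum>j\<in>A. c j * F j x)"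
  by (induction xs) (simp_all add: distrib_left sum.distrib)

text \<open>
  For each number of segments the two cost models agree exactly, once \<open>\<Phi>\<close> is replaced by its
  interpolation. The denominator \<open>eta_dis B * E_rate B\<close> of the segment costs converts the energy
  delivered by a segment into cycle depth.
\<close>

lemma pwl_cost_eq_interpolate:
  assumes "valid_battery B" "e0 \<in> {E_min B..E_max B}" "(d, g) \<in> feasible_dispatches B e0" "0 < J"
    and "rainflow (local_extrema (soc_profile B e0 d g)) = (full, residue)"
  shows "pwl_cost B e0 (linearization B \<Phi> J) d g
       = cell_cost B * (\<Sum>\<delta>\<leftarrow>full @ discharge_half_cycles residue. interpolate \<Phi> J \<delta>)"
    and "set (full @ discharge_half_cycles residue) \<subseteq> {0..1}"
proof -
  interpret segmented_battery B J e0 d g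
    using assms(1-4) by unfold_locales (auto simp: valid_battery_def)
  let ?depths = "full @ discharge_half_cycles residue"
  have e0: "e0 \<le> E_rate B" using assms(1,2) by (auto simp: valid_battery_def)
  have profile: "soc_profile B e0 d g \<noteq> []" "set (soc_profile B e0 d g) \<subseteq> {0..1}"
      "hd (soc_profile B e0 d g) = soc 0"
    using soc_bounds[OF _ e0]
    by (auto simp: soc_profile_def upt_conv_Cons simp del: upt_Suc energy_level.simps)
  show "set ?depths \<subseteq> {0..1}"
    using drained_rainflow(2)[OF profile(1,2) _ assms(5), of 0] by simp
  define S where "S k = (\<Sum>t\<in>{1..horizon B}. \<Sum>j\<in>{1..k}. segment_discharge B J e0 d g t j)" for k
  have S: "interval B * S k = eta_dis B * E_rate B * (\<Sum>\<delta>\<leftarrow>?depths. min \<delta> (real k / real J))" for k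
    using sum_segment_discharge[of k] drained_rainflow(1)[OF profile(1,2) _ assms(5), of "real k / real J"]
      params unfolding profile(3) S_def[symmetric] by (simp add: field_simps)
  have discharged: "interval B * (\<Sum>t\<in>{1..horizon B}. segment_discharge B J e0 d g t j)
      = eta_dis B * E_rate B * (\<Sum>\<delta>\<leftarrow>?depths. min \<delta> (real j / real J) - min \<delta> ((real j - 1) / real J))"
    if pos: "1 \<le> j" for j
  proof -
    obtain i where i: "j = Suc i" using pos by (cases j) auto
    have "(\<Sum>t\<in>{1..horizon B}. segment_discharge B J e0 d g t j) = S (Suc i) - S i"
      unfolding S_def i by (simp add: sum.distrib)
    then show ?thesis
      using S[of "Suc i"] S[of i] by (simp only: right_diff_distrib sum_list_subtractf) (simp add: i algebra_simps)
  qed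
  have "pwl_cost B e0 (linearization B \<Phi> J) d g
      = (\<Sum>t\<in>{1..horizon B}. \<Sum>j\<in>{1..J}. interval B * linearization B \<Phi> J ! (j - 1)
           * segment_discharge B J e0 d g t j)"
    by (simp add: pwl_cost_def linearization_def)
  also have "\<dots> = (\<Sum>j\<in>{1..J}. linearization B \<Phi> J ! (j - 1)
           * (interval B * (\<Sum>t\<in>{1..horizon B}. segment_discharge B J e0 d g t j)))"
    by (subst sum.swap) (simp add: sum_distrib_left mult_ac)
  also have "\<dots> = (\<Sum>j\<in>{1..J}. cell_cost B * (real J * (\<Phi> (real j / real J) - \<Phi> ((real j - 1) / real J))
           * (\<Sum>\<delta>\<leftarrow>?depths. min \<delta> (real j / real J) - min \<delta> ((real j - 1) / real J))))"
  proof (intro sum.cong refl)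
    fix j assume j: "j \<in> {1..J}"
    then have "linearization B \<Phi> J ! (j - 1) = cell_cost B / (eta_dis B * E_rate B) * real J
               * (\<Phi> (real j / real J) - \<Phi> ((real j - 1) / real J))"
      unfolding linearization_def by (subst nth_map) (auto simp del: upt_Suc)
    then show "linearization B \<Phi> J ! (j - 1)
           * (interval B * (\<Sum>t\<in>{1..horizon B}. segment_discharge B J e0 d g t j))
         = cell_cost B * (real J * (\<Phi> (real j / real J) - \<Phi> ((real j - 1) / real J))
           * (\<Sum>\<delta>\<leftarrow>?depths. min \<delta> (real j / real J) - min \<delta> ((real j - 1) / real J)))"
      using discharged[of j] j params by simp
  qed
  also have "\<dots> = cell_cost B * (\<Sum>\<delta>\<leftarrow>?depths. interpolate \<Phi> J \<delta>)"
    unfolding interpolate_def sum_distrib_left[symmetric] sum_mult_sum_list ..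
  finally show "pwl_cost B e0 (linearization B \<Phi> J) d g
       = cell_cost B * (\<Sum>\<delta>\<leftarrow>?depths. interpolate \<Phi> J \<delta>)" .
qed

theorem theorem2:
  fixes B :: battery and \<Phi> :: "real \<Rightarrow> real" and e0 :: real
    and d g :: "nat \<Rightarrow> real"
  assumes "valid_battery B"
    and "stress_function \<Phi>"
    and "convex_on {0..1} \<Phi>"
    and "e0 \<in> {E_min B..E_max B}"
    and "(d, g) \<in> feasible_dispatches B e0"
  shows "(\<lambda>J. pwl_cost B e0 (linearization B \<Phi> J) d g) \<longlonglongrightarrow> benchmark_cost B e0 \<Phi> d g"
proof -
  obtain full residue where r: "rainflow (local_extrema (soc_profile B e0 d g)) = (full, residue)"
    by fastforce
  let ?depths = "full @ discharge_half_cycles residue"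
  note pwl = pwl_cost_eq_interpolate[OF assms(1,4,5) _ r]
  have "continuous_on {0..1} \<Phi>" "\<Phi> 0 = 0"
    using assms(2) differentiable_imp_continuous_on by (auto simp: stress_function_def)
  then have termwise: "(\<lambda>J. \<Sum>\<delta>\<leftarrow>ds. interpolate \<Phi> J \<delta>) \<longlonglongrightarrow> (\<Sum>\<delta>\<leftarrow>ds. \<Phi> \<delta>)" if "set ds \<subseteq> {0..1}" for ds
    using that by (induction ds) (auto intro!: tendsto_add interpolate_tendsto)
  have "(\<lambda>J. cell_cost B * (\<Sum>\<delta>\<leftarrow>?depths. interpolate \<Phi> J \<delta>))
      \<longlonglongrightarrow> cell_cost B * (\<Sum>\<delta>\<leftarrow>?depths. \<Phi> \<delta>)"
    by (intro tendsto_mult_left termwise pwl(2)[of 1] zero_less_one)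
  moreover have "\<forall>\<^sub>F J in sequentially. pwl_cost B e0 (linearization B \<Phi> J) d g
      = cell_cost B * (\<Sum>\<delta>\<leftarrow>?depths. interpolate \<Phi> J \<delta>)"
    using eventually_gt_at_top[of 0] by eventually_elim (rule pwl(1))
  moreover have "benchmark_cost B e0 \<Phi> d g = cell_cost B * (\<Sum>\<delta>\<leftarrow>?depths. \<Phi> \<delta>)"
    by (simp add: benchmark_cost_def r algebra_simps)
  ultimately show ?thesis by (simp add: tendsto_cong)
qed

end
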